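(* Let $r\in(0,1]$, $\gamma\in(0,1]$, $\lambda>0$, and let $$F(x;r,\gamma,\lambda)=\left(\frac{\lambda x^{\gamma}}{1+\lambda x^{\gamma}}\right)^r,\qquad x\ge0.$$ Then the distribution function $F(x;r,\gamma,\lambda)$ is mixed exponential: $$1-F(x;r,\gamma,\lambda)=\int_{0}^{\infty}e^{-ux}\,dA(u),\qquad x\ge0,$$ where $$A(u)=\mathsf{P}\big(W_1R_{\gamma}Z_{r,\lambda}^{1/\gamma}<u\big),\qquad u\ge0,$$ and the random variables $W_1$, $R_\gamma$, $Z_{r,\lambda}$ are independent.
   Context: $W_1$ is a standard exponential random variable. $S_{\gamma,1}$ ($0<\gamma\le1$) has the one-sided strictly stable distribution on $[0,\infty)$ with characteristic function $\exp\{-|t|^{\gamma}\exp\{-\frac12 i\pi\gamma\,\mathrm{sign}\,t\}\}$, $t\in\mathbb{R}$; for $\gamma=1$ it is degenerate: $S_{1,1}=1$ almost surely. $R_\gamma=S_{\gamma,1}/S'_{\gamma,1}$, where $S_{\gamma,1}$ and $S'_{\gamma,1}$ are independent and identically distributed. For $\gamma\in(0,1)$ it has the density $$v_\gamma(x)=\frac{\sin(\pi\gamma)x^{\gamma-1}}{\pi[1+x^{2\gamma}+2x^\gamma\cos(\pi\gamma)]},\quad x>0;$$ for $\gamma=1$, $R_1=1$ almost surely. For $r\in(0,1)$ and $\lambda>0$, $$Z_{r,\lambda}=\frac{\lambda(G_{r,1}+G_{1-r,1})}{G_{r,1}},$$ where $G_{r,1}$ and $G_{1-r,1}$ are independent,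 $G_{s,1}$ having the gamma density $\frac{1}{\Gamma(s)}x^{s-1}e^{-x}$, $x\ge0$; for $r=1$, $Z_{1,\lambda}=\lambda$ (the convention $G_{0,1}=0$). *)

theory Defs
  imports "HOL-Probability.Probability"
begin

definition mixture_df :: "real \<Rightarrow> real \<Rightarrow> real \<Rightarrow> real \<Rightarrow> real" where
  "mixture_df r \<gamma> l x = (l * x powr \<gamma> / (1 + l * x powr \<gamma>)) powr r"

definition one_sided_stable_law :: "real \<Rightarrow> real measure \<Rightarrow> bool" where
  "one_sided_stable_law \<gamma> \<mu> \<longleftrightarrow>
     real_distribution \<mu> \<and> (AE x in \<mu>. 0 \<le> x) \<and>
     (\<forall>t. char \<mu> t =
        exp (- (complex_of_real (\<bar>t\<bar> powr \<gamma>) *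
                exp (- (\<i> * complex_of_real (pi * \<gamma> * sgn t / 2))))))"

definition gamma_density :: "real \<Rightarrow> real \<Rightarrow> real" where
  "gamma_density s x = (if x < 0 then 0 else x powr (s - 1) * exp (- x) / Gamma s)"

text \<open>The gamma law with shape \<open>s\<close> and unit scale, with the convention that it is the point mass
  at 0 for \<open>s = 0\<close>.\<close>

definition gamma_law :: "real \<Rightarrow> real measure" where
  "gamma_law s = (if s = 0 then return borel 0 else density lborel (\<lambda>x. ennreal (gamma_density s x)))"

text \<open>The Lebesgue-Stieltjes measure \<open>dA\<close> of a nondecreasing function \<open>A\<close>, which need not be
  right-continuous: \<open>interval_measure\<close> is only meaningful for right-continuous functions, so it is
  applied to the right limits of \<open>A\<close>. If \<open>A\<close> is left-continuous, as is \<open>\<lambda>u. P(X < u)\<close>, this measure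
  assigns the mass \<open>A b - A a\<close> to \<open>{a..<b}\<close>.\<close>

definition stieltjes_measure :: "(real \<Rightarrow> real) \<Rightarrow> real measure" where
  "stieltjes_measure A = interval_measure (\<lambda>u. Lim (at_right u) A)"

end

theory Submission
  imports Defs "HOL-Complex_Analysis.Complex_Analysis" "HOL-Real_Asymp.Real_Asymp"
begin

text \<open>
  Integrating out \<open>W\<close>, then \<open>R\<close>, then \<open>Z\<close> in \<open>E exp (- x W R Z\<^sup>1\<^sup>/\<^sup>\<gamma>)\<close> uses the transforms
  \<open>E exp (- a W) = 1 / (1 + a)\<close>, \<open>E (1 / (1 + y R)) = 1 / (1 + y\<^sup>\<gamma>)\<close> and
  \<open>E (1 / (1 + c (G + H) / G)) = 1 - (c / (1 + c))\<^sup>r\<close>, the last one for \<open>c = l x\<^sup>\<gamma>\<close>.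
  The second one rests on the Laplace transform \<open>exp (- s\<^sup>\<gamma>)\<close> of the stable law. It is obtained from the
  characteristic function by uniqueness of bounded analytic functions: the difference of
  \<open>E exp (- z S)\<close> and \<open>exp (- z\<^sup>\<gamma>)\<close> is bounded and holomorphic on the right half-plane and vanishes on
  its boundary, so the maximum principle on half-discs, applied after division by \<open>1 + z\<close>, shows
  that it is zero.
\<close>

section \<open>Bounded analytic functions on the right half-plane\<close>

text \<open>On the arc of a half-disc only the bound \<open>B\<close> is known for \<open>f\<close>,
  so the maximum principle for \<open>f\<close> itself would not give zero. The divisor
  \<open>1 + z\<close> has no zero for Re z \<ge> 0 and modulus at least R on the arc, so the
  quotient is at most \<open>B / R\<close> on the whole frontier, and R can tend to
  infinity.\<close>

lemma bounded_holomorphic_halfplane_eq_0: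
  fixes f :: "complex \<Rightarrow> complex"
  assumes hol: "f holomorphic_on {z. 0 < Re z}"
    and cont: "continuous_on {z. 0 \<le> Re z} f"
    and bound: "\<And>z. 0 \<le> Re z \<Longrightarrow> norm (f z) \<le> B"
    and zero: "\<And>z. Re z = 0 \<Longrightarrow> f z = 0"
    and \<xi>: "0 < Re \<xi>"
  shows "f \<xi> = 0"
proof -
  have B: "0 \<le> B"
    using order_trans[OF norm_ge_zero bound[of 0]] by simp
  have ne: "1 + z \<noteq> 0" if "0 \<le> Re z" for z :: complex
    using that by (auto simp: complex_eq_iff)
  have *: "norm (f \<xi> / (1 + \<xi>)) \<le> B / R" if R: "norm \<xi> < R" for R
  proof -
    let ?S = "{z. 0 < Re z} \<inter> ball 0 R"
    have Rpos: "0 < R" using R norm_ge_zero[of \<xi>] by linarith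
    have op: "open ?S" by (intro open_Int open_halfspace_Re_gt open_ball)
    have int: "interior ?S = ?S" using op by (rule interior_open)
    have "closed ({z. 0 \<le> Re z} \<inter> cball 0 R)"
      by (intro closed_Int closed_halfspace_Re_ge closed_cball)
    then have cl: "closure ?S \<subseteq> {z. 0 \<le> Re z} \<inter> cball 0 R"
      by (intro closure_minimal) auto
    show ?thesis
    proof (rule maximum_modulus_frontier[where f = "\<lambda>z. f z / (1 + z)" and S = ?S])
      show "(\<lambda>z. f z / (1 + z)) holomorphic_on interior ?S"
        unfolding int using ne
        by (intro holomorphic_intros holomorphic_on_subset[OF hol]) auto
      show "continuous_on (closure ?S) (\<lambda>z. f z / (1 + z))"
        using cl ne by (intro continuous_intros continuous_on_subset[OF cont]) auto
      show "bounded ?S" by auto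
      show "\<xi> \<in> ?S" using \<xi> R by auto
      show "norm (f z / (1 + z)) \<le> B / R" if "z \<in> frontier ?S" for z
      proof -
        have z: "0 \<le> Re z" "norm z \<le> R" "\<not> (0 < Re z \<and> norm z < R)"
          using that cl unfolding frontier_def int by auto
        show ?thesis
        proof (cases "Re z = 0")
          case True
          then show ?thesis using zero B Rpos by simp
        next
          case False
          then have "norm z = R" using z by linarith
          moreover have "norm z \<le> norm (1 + z)"
            unfolding cmod_def using z(1) by (intro real_sqrt_le_mono) (simp add: power2_eq_square algebra_simps)
          ultimately show ?thesis
            using bound[OF z(1)] B Rpos by (auto simp: norm_divide intro!: frac_le)
        qed
      qed
    qed
  qed
  have "((\<lambda>R. B / R) \<longlongrightarrow> 0) at_top" by real_asymp
  then have "norm (f \<xi> / (1 + \<xi>)) \<le> 0"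
    by (rule tendsto_lowerbound)
       (use * in \<open>auto intro!: eventually_mono[OF eventually_gt_at_top[of "norm \<xi>"]]\<close>)
  then show ?thesis using ne \<xi> by auto
qed

section \<open>Laplace transforms of finite measures on the half-line\<close>

text \<open>Differentiation under the integral sign by dominated convergence. No moment of \<mu>
  needs to be finite, because the exponential decay at a point with positive real part absorbs the
  factor x.\<close>

lemma has_field_derivative_laplace:
  fixes \<mu> :: "real measure"
  assumes "finite_measure \<mu>" and sets: "sets \<mu> = sets borel"
    and nonneg: "AE x in \<mu>. 0 \<le> x" and z: "0 < Re z"
  shows "((\<lambda>z. LINT x|\<mu>. exp (- (z * complex_of_real x))) has_field_derivative
          (LINT x|\<mu>. - complex_of_real x * exp (- (z * complex_of_real x)))) (at z)"
proof -
  interpret finite_measure \<mu> by fact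
  note [measurable_cong] = sets
  \<comment> \<open>Half the real part of z gives a half-plane \<open>H\<close> around z with a
    positive distance from the imaginary axis. There the derivative of the integrand is bounded by
    \<open>1 / \<delta>\<close>, uniformly in x \<ge> 0.\<close>
  define \<delta> where "\<delta> = Re z / 2"
  define H where "H = {w. \<delta> < Re w}"
  have \<delta>: "0 < \<delta>" using z by (simp add: \<delta>_def)
  have H: "open H" "convex H" "z \<in> H"
    unfolding H_def using z by (auto simp: open_halfspace_Re_gt convex_halfspace_Re_gt) (simp add: \<delta>_def)
  have deriv: "((\<lambda>z. exp (- (z * complex_of_real x))) has_field_derivative
      - complex_of_real x * exp (- (w * complex_of_real x))) (at w within A)" for w x A
    by (auto intro!: derivative_eq_intros)
  have le: "norm (- complex_of_real x * exp (- (w * complex_of_real x))) \<le> 1 / \<delta>"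
    if "0 \<le> x" "w \<in> H" for x w
  proof -
    have "exp (- (Re w * x)) \<le> exp (- (\<delta> * x))"
      using that by (auto simp: H_def intro!: mult_right_mono)
    moreover have "\<delta> * x \<le> exp (\<delta> * x)"
      using exp_ge_add_one_self[of "\<delta> * x"] by linarith
    then have "x * exp (- (\<delta> * x)) \<le> 1 / \<delta>"
      using \<delta> by (simp add: exp_minus field_simps)
    ultimately have "x * exp (- (Re w * x)) \<le> 1 / \<delta>"
      using that(1) by (meson mult_left_mono order_trans)
    then show ?thesis using that(1) by (simp add: norm_mult)
  qed
  have int: "integrable \<mu> (\<lambda>x. exp (- (w * complex_of_real x)))" if "w \<in> H" for w
  proof (rule integrable_const_bound[where B = 1])
    show "AE x in \<mu>. norm (exp (- (w * complex_of_real x))) \<le> 1"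
      using nonneg by eventually_elim (use that \<delta> in \<open>auto simp: H_def\<close>)
  qed simp
  have "((\<lambda>y. ((LINT x|\<mu>. exp (- (y * complex_of_real x))) - (LINT x|\<mu>. exp (- (z * complex_of_real x)))) / (y - z))
     \<longlongrightarrow> (LINT x|\<mu>. - complex_of_real x * exp (- (z * complex_of_real x)))) (at z within H)"
    unfolding tendsto_at_iff_sequentially
  proof (intro allI impI)
    fix X assume X: "\<forall>i. X i \<in> H - {z}" "X \<longlonglongrightarrow> z"
    have eq: "(LINT x|\<mu>. (exp (- (X i * complex_of_real x)) - exp (- (z * complex_of_real x))) / (X i - z)) =
       ((LINT x|\<mu>. exp (- (X i * complex_of_real x))) - (LINT x|\<mu>. exp (- (z * complex_of_real x)))) / (X i - z)" for i
      using X(1) H(3) by (subst Bochner_Integration.integral_diff[symmetric]) (auto intro!: int)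
    have "(\<lambda>i. LINT x|\<mu>. (exp (- (X i * complex_of_real x)) - exp (- (z * complex_of_real x))) / (X i - z))
        \<longlonglongrightarrow> (LINT x|\<mu>. - complex_of_real x * exp (- (z * complex_of_real x)))"
    proof (rule integral_dominated_convergence[where w = "\<lambda>_. 1 / \<delta>"])
      show "AE x in \<mu>. (\<lambda>i. (exp (- (X i * complex_of_real x)) - exp (- (z * complex_of_real x))) / (X i - z))
          \<longlonglongrightarrow> - complex_of_real x * exp (- (z * complex_of_real x))"
      proof (rule AE_I2)
        fix x
        show "(\<lambda>i. (exp (- (X i * complex_of_real x)) - exp (- (z * complex_of_real x))) / (X i - z))
          \<longlonglongrightarrow> - complex_of_real x * exp (- (z * complex_of_real x))"
          using deriv[of x z H] X unfolding has_field_derivative_iff tendsto_at_iff_sequentially comp_def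
          by blast
      qed
      show "AE x in \<mu>. norm ((exp (- (X i * complex_of_real x)) - exp (- (z * complex_of_real x))) / (X i - z)) \<le> 1 / \<delta>" for i
        using nonneg
      proof eventually_elim
        case (elim x)
        \<comment> \<open>The mean value inequality on the convex set \<open>H\<close> turns the
          bound on the derivative into one on the difference quotients, which serves as the
          integrable majorant.\<close>
        have "norm (exp (- (X i * complex_of_real x)) - exp (- (z * complex_of_real x))) \<le> 1 / \<delta> * norm (X i - z)"
          using X(1) H elim by (intro field_differentiable_bound[OF H(2) deriv le]) auto
        then show ?case using X(1) by (auto simp: norm_divide divide_simps)
      qed
    qed auto
    then show "((\<lambda>y. ((LINT x|\<mu>. exp (- (y * complex_of_real x))) - (LINT x|\<mu>. exp (- (z * complex_of_real x)))) / (y - z)) \<circ> X)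
      \<longlonglongrightarrow> (LINT x|\<mu>. - complex_of_real x * exp (- (z * complex_of_real x)))"
      unfolding comp_def eq .
  qed
  then show ?thesis
    unfolding has_field_derivative_iff at_within_open[OF H(3,1)] .
qed

text \<open>The integrand is dominated by 1 on the closed half-plane. The boundary is included
  because the characteristic function lives there.\<close>

lemma continuous_on_laplace:
  fixes \<mu> :: "real measure"
  assumes "finite_measure \<mu>" and sets: "sets \<mu> = sets borel" and nonneg: "AE x in \<mu>. 0 \<le> x"
  shows "continuous_on {z. 0 \<le> Re z} (\<lambda>z. LINT x|\<mu>. exp (- (z * complex_of_real x)))"
  unfolding continuous_on_def tendsto_at_iff_sequentially comp_def
proof (intro ballI allI impI)
  interpret finite_measure \<mu> by fact
  note [measurable_cong] = sets
  fix z X assume X: "\<forall>i. X i \<in> {z. 0 \<le> Re z} - {z}" "X \<longlonglongrightarrow> z"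
  show "(\<lambda>i. LINT x|\<mu>. exp (- (X i * complex_of_real x))) \<longlonglongrightarrow> (LINT x|\<mu>. exp (- (z * complex_of_real x)))"
  proof (rule integral_dominated_convergence[where w = "\<lambda>_. 1"])
    show "AE x in \<mu>. (\<lambda>i. exp (- (X i * complex_of_real x))) \<longlonglongrightarrow> exp (- (z * complex_of_real x))"
      by (intro AE_I2 tendsto_intros X)
    show "AE x in \<mu>. norm (exp (- (X i * complex_of_real x))) \<le> 1" for i
      using nonneg by eventually_elim (use X(1) in auto)
  qed auto
qed

section \<open>Complex powers and the Laplace transform of the stable law\<close>

text \<open>The argument of the power is \<gamma> times that of z, and a factor of at most 1 keeps
  it within [-pi/2, pi/2]. Hence \<open>exp (- (z powr \<gamma>))\<close> has modulus at most 1 on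
  the closed half-plane.\<close>

lemma Re_powr_nonneg:
  assumes "0 \<le> Re z" "0 < \<gamma>" "\<gamma> \<le> (1::real)"
  shows "0 \<le> Re (z powr complex_of_real \<gamma>)"
proof (cases "z = 0")
  case False
  have "\<bar>Im (Ln z)\<bar> \<le> pi / 2"
    using Re_Ln_pos_le[OF False] assms(1) by simp
  then have "\<bar>\<gamma> * Im (Ln z)\<bar> \<le> pi / 2"
    using assms mult_mono[of \<gamma> 1 "\<bar>Im (Ln z)\<bar>" "pi / 2"] by (simp add: abs_mult)
  then have "0 \<le> cos (\<gamma> * Im (Ln z))"
    by (intro cos_ge_zero) auto
  then show ?thesis
    using False by (simp add: powr_def Re_exp)
qed simp

text \<open>The principal argument of -it is -pi/2 times the sign of t. So the exponent in the
  characteristic function of the stable law is the boundary value of -(z powr \<gamma>) at z =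
  -it.\<close>

lemma powr_imaginary:
  "(- (\<i> * complex_of_real t)) powr complex_of_real \<gamma> =
    complex_of_real (\<bar>t\<bar> powr \<gamma>) * exp (- (\<i> * complex_of_real (pi * \<gamma> * sgn t / 2)))"
proof (cases "t = 0")
  case False
  have "Ln (- (\<i> * complex_of_real t)) = complex_of_real (ln \<bar>t\<bar>) - \<i> * complex_of_real (pi * sgn t / 2)"
  proof (cases "0 < t")
    case True
    then show ?thesis
      using Ln_times_of_real[of t "- \<i>"] Ln_of_real[of t] by (simp add: mult.commute)
  next
    \<comment> \<open>For t < 0, -it is the positive multiple -t of the imaginary unit, so its
      logarithm splits without crossing the branch cut.\<close>
    case f: False
    then have t: "0 < - t" using False by simp
    have "Ln (- (\<i> * complex_of_real t)) = Ln (complex_of_real (- t) * \<i>)"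
      by (simp add: mult.commute)
    also have "\<dots> = complex_of_real (ln (- t)) + Ln \<i>"
      using t by (simp only: Ln_times_of_real Ln_of_real complex_i_not_zero not_False_eq_True)
    finally show ?thesis
      using f False by (simp add: mult.commute)
  qed
  then have "complex_of_real \<gamma> * Ln (- (\<i> * complex_of_real t)) =
      complex_of_real (\<gamma> * ln \<bar>t\<bar>) + - (\<i> * complex_of_real (pi * \<gamma> * sgn t / 2))"
    by (simp only:) (simp add: algebra_simps)
  then have "(- (\<i> * complex_of_real t)) powr complex_of_real \<gamma> =
      exp (complex_of_real (\<gamma> * ln \<bar>t\<bar>) + - (\<i> * complex_of_real (pi * \<gamma> * sgn t / 2)))"
    using False by (simp only: powr_def) simp
  then show ?thesis
    using False by (simp only: exp_add) (simp add: powr_def flip: exp_of_real)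
qed simp

lemma one_sided_stable_law_laplace_complex:
  assumes \<mu>: "one_sided_stable_law \<gamma> \<mu>" and \<gamma>: "0 < \<gamma>" "\<gamma> \<le> 1" and z: "0 < Re z"
  shows "(LINT x|\<mu>. exp (- (z * complex_of_real x))) = exp (- (z powr complex_of_real \<gamma>))"
proof -
  interpret real_distribution \<mu> using \<mu> by (simp add: one_sided_stable_law_def)
  have nonneg: "AE x in \<mu>. 0 \<le> x" using \<mu> by (simp add: one_sided_stable_law_def)
  define f where "f = (\<lambda>z. (LINT x|\<mu>. exp (- (z * complex_of_real x))) - exp (- (z powr complex_of_real \<gamma>)))"
  have "f z = 0"
  \<comment> \<open>The bound 2 is the sum of the bounds 1 for the two terms of
    \<open>f\<close>.\<close>
  proof (rule bounded_holomorphic_halfplane_eq_0[where f = f and B = 2])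
    have "(\<lambda>z. LINT x|\<mu>. exp (- (z * complex_of_real x))) holomorphic_on {z. 0 < Re z}"
      by (auto simp: holomorphic_on_open open_halfspace_Re_gt
          intro!: exI has_field_derivative_laplace nonneg finite_measure_axioms)
    then show "f holomorphic_on {z. 0 < Re z}"
      unfolding f_def by (intro holomorphic_intros) (auto simp: complex_nonpos_Reals_iff)
    \<comment> \<open>The closed half-plane meets the branch cut only at 0, where the power is
      continuous because \<gamma> > 0.\<close>
    show "continuous_on {z. 0 \<le> Re z} f"
      unfolding f_def using \<gamma>
      by (intro continuous_intros continuous_on_laplace nonneg finite_measure_axioms) auto
    show "norm (f z) \<le> 2" if "0 \<le> Re z" for z
    proof -
      have "norm (LINT x|\<mu>. exp (- (z * complex_of_real x))) \<le> 1"
      proof (rule order_trans[OF integral_norm_bound])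
        have "(LINT x|\<mu>. norm (exp (- (z * complex_of_real x)))) \<le> (LINT x|\<mu>. 1)"
        proof (rule integral_mono_AE)
          show "AE x in \<mu>. norm (exp (- (z * complex_of_real x))) \<le> 1"
            using nonneg by eventually_elim (use that in auto)
          then show "integrable \<mu> (\<lambda>x. norm (exp (- (z * complex_of_real x))))"
            by (intro integrable_norm integrable_const_bound[where B = 1]) auto
        qed simp
        then show "(LINT x|\<mu>. norm (exp (- (z * complex_of_real x)))) \<le> 1"
          by (simp add: prob_space del: space_eq_univ)
      qed
      moreover have "norm (exp (- (z powr complex_of_real \<gamma>))) \<le> 1"
        using Re_powr_nonneg[OF that \<gamma>] by simp
      ultimately show ?thesis
        unfolding f_def using norm_triangle_ineq4 by (smt (verit))
    qed
    show "f z = 0" if "Re z = 0" for z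
    proof -
      \<comment> \<open>With t = - Im z the Laplace integrand at z is exp(itx), the integrand of the
        characteristic function at t.\<close>
      have zt: "z = - (\<i> * complex_of_real (- Im z))"
        using that by (simp add: complex_eq_iff)
      have "char \<mu> (- Im z) = (LINT x|\<mu>. exp (- (z * complex_of_real x)))"
        unfolding char_def by (subst (2) zt) (simp add: algebra_simps)
      moreover have "char \<mu> (- Im z) = exp (- ((- (\<i> * complex_of_real (- Im z))) powr complex_of_real \<gamma>))"
        using \<mu> unfolding powr_imaginary one_sided_stable_law_def by blast
      ultimately show ?thesis
        unfolding f_def zt[symmetric] by (metis cancel_comm_monoid_add_class.diff_cancel)
    qed
  qed (use z in auto)
  then show ?thesis by (simp add: f_def)
qed

text \<open>Real arguments suffice from here on, and the nonnegative integral is the form to which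
  Tonelli's theorem applies. The boundary point s = 0 is settled by the total mass.\<close>

lemma one_sided_stable_law_laplace:
  assumes \<mu>: "one_sided_stable_law \<gamma> \<mu>" and \<gamma>: "0 < \<gamma>" "\<gamma> \<le> 1" and s: "0 \<le> s"
  shows "(\<integral>\<^sup>+x. ennreal (exp (- (s * x))) \<partial>\<mu>) = ennreal (exp (- (s powr \<gamma>)))"
proof -
  interpret real_distribution \<mu> using \<mu> by (simp add: one_sided_stable_law_def)
  have nonneg: "AE x in \<mu>. 0 \<le> x" using \<mu> by (simp add: one_sided_stable_law_def)
  have int: "integrable \<mu> (\<lambda>x. exp (- (s * x)))"
    by (rule integrable_const_bound[where B = 1])
       (use nonneg s in \<open>auto elim!: eventually_mono\<close>)
  have "(LINT x|\<mu>. exp (- (s * x))) = exp (- (s powr \<gamma>))"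
  proof (cases "s = 0")
    case False
    then have "complex_of_real (LINT x|\<mu>. exp (- (s * x))) = complex_of_real (exp (- (s powr \<gamma>)))"
      using one_sided_stable_law_laplace_complex[OF \<mu> \<gamma>, of "complex_of_real s"] s
      by (simp add: powr_of_real exp_of_real[symmetric] flip: integral_complex_of_real)
    then show ?thesis by simp
  qed (simp add: prob_space del: space_eq_univ)
  then show ?thesis
    by (subst nn_integral_eq_integral[OF int]) auto
qed

text \<open>The mass at 0 is at most the Laplace transform at every s \<ge> 0, and this tends to 0
  as s grows. It follows that the denominator of the stable quotient is almost surely
  nonzero.\<close>

lemma one_sided_stable_law_AE_pos:
  assumes \<mu>: "one_sided_stable_law \<gamma> \<mu>" and \<gamma>: "0 < \<gamma>" "\<gamma> \<le> 1"
  shows "AE x in \<mu>. 0 < x"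
proof -
  interpret real_distribution \<mu> using \<mu> by (simp add: one_sided_stable_law_def)
  have nonneg: "AE x in \<mu>. 0 \<le> x" using \<mu> by (simp add: one_sided_stable_law_def)
  have le: "measure \<mu> {0} \<le> exp (- (s powr \<gamma>))" if "0 \<le> s" for s
  proof -
    have "emeasure \<mu> {0} = (\<integral>\<^sup>+x. indicator {0} x \<partial>\<mu>)" by simp
    also have "\<dots> \<le> (\<integral>\<^sup>+x. ennreal (exp (- (s * x))) \<partial>\<mu>)"
      by (intro nn_integral_mono) (auto simp: indicator_def)
    finally show ?thesis
      using one_sided_stable_law_laplace[OF \<mu> \<gamma> that] by (simp add: emeasure_eq_measure)
  qed
  have "((\<lambda>s. exp (- (s powr \<gamma>))) \<longlongrightarrow> 0) at_top"
    using \<gamma> by real_asymp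
  then have "measure \<mu> {0} \<le> 0"
    by (rule tendsto_lowerbound) (use le in \<open>auto intro!: eventually_mono[OF eventually_ge_at_top[of 0]]\<close>)
  then have "AE x in \<mu>. x \<noteq> 0"
    by (intro AE_I[where N = "{0}"]) (auto simp: emeasure_eq_measure measure_le_0_iff)
  with nonneg show ?thesis by eventually_elim simp
qed

lemma one_minus_ennreal: "0 \<le> a \<Longrightarrow> 1 - ennreal a = ennreal (1 - a)"
  by (metis ennreal_1 ennreal_minus)

section \<open>The exponential law and the quotient of independent stable variables\<close>

abbreviation exponential_law :: "real measure" where
  "exponential_law \<equiv> density lborel (exponential_density 1)"

lemma prob_space_exponential_law: "prob_space exponential_law"
  by (rule prob_space_exponential_density) simp

lemma AE_exponential_law_pos: "AE w in exponential_law. 0 < w"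
proof -
  have "AE w in lborel. w \<noteq> (0::real)" by (rule AE_lborel_singleton)
  then show ?thesis
    by (subst AE_density) (auto elim!: eventually_mono simp: exponential_density_def split: if_splits)
qed

lemma nn_integral_exp_atLeast_0:
  assumes "0 < c"
  shows "(\<integral>\<^sup>+w. ennreal (exp (- (c * w))) * indicator {0..} w \<partial>lborel) = ennreal (1 / c)"
proof -
  have "(\<integral>\<^sup>+w. ennreal (exp (- (c * w))) * indicator {0..} w \<partial>lborel) = ennreal (0 - (- exp (- (c * 0)) / c))"
  proof (rule nn_integral_FTC_atLeast)
    show "((\<lambda>w. - exp (- (c * w)) / c) \<longlongrightarrow> 0) at_top"
      using assms by real_asymp
  qed (use assms in \<open>auto intro!: derivative_eq_intros\<close>)
  then show ?thesis by simp
qed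

lemma nn_integral_exp_exponential_law:
  assumes "0 \<le> a"
  shows "(\<integral>\<^sup>+w. ennreal (exp (- (a * w))) \<partial>exponential_law) = ennreal (1 / (1 + a))"
proof -
  have "(\<integral>\<^sup>+w. ennreal (exp (- (a * w))) \<partial>exponential_law) =
      (\<integral>\<^sup>+w. ennreal (exp (- ((1 + a) * w))) * indicator {0..} w \<partial>lborel)"
    by (subst nn_integral_density)
       (auto intro!: nn_integral_cong simp: exponential_density_def indicator_def ennreal_mult[symmetric]
             exp_add[symmetric] algebra_simps)
  then show ?thesis using assms by (simp add: nn_integral_exp_atLeast_0)
qed

lemma emeasure_exponential_law_lessThan:
  assumes "0 \<le> t"
  shows "emeasure exponential_law {..<t} = ennreal (1 - exp (- t))"
proof -
  \<comment> \<open>The law has no atoms, so the endpoint t can be added.\<close>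
  have "emeasure exponential_law {..<t} = emeasure exponential_law {..t}"
  proof (rule emeasure_eq_AE)
    have "AE w in lborel. w \<noteq> t" by (rule AE_lborel_singleton)
    then show "AE w in exponential_law. w \<in> {..<t} \<longleftrightarrow> w \<in> {..t}"
      by (subst AE_density) (auto elim!: eventually_mono)
  qed auto
  also have "\<dots> = ennreal (erlang_CDF 0 1 t)"
    using emeasure_erlang_density[of 1 0 t] by simp
  finally show ?thesis using assms by (simp add: erlang_CDF_def)
qed

lemma exp_eq_emeasure_exponential_law:
  assumes "0 \<le> t"
  shows "ennreal (exp (- t)) = emeasure exponential_law {t<..}"
proof -
  interpret prob_space exponential_law by (rule prob_space_exponential_law)
  have "{t<..} = space exponential_law - {..t}" by auto
  then have "emeasure exponential_law {t<..} = emeasure exponential_law (space exponential_law - {..t})"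
    by (rule arg_cong)
  also have "\<dots> = emeasure exponential_law (space exponential_law) - emeasure exponential_law {..t}"
    by (rule emeasure_compl) (auto simp: emeasure_finite simp del: emeasure_density)
  also have "emeasure exponential_law (space exponential_law) = 1"
    by (rule emeasure_space_1)
  also have "emeasure exponential_law {..t} = ennreal (erlang_CDF 0 1 t)"
    using emeasure_erlang_density[of 1 0 t] by simp
  finally show ?thesis using assms
    by (simp add: erlang_CDF_def one_minus_ennreal)
qed

text \<open>Writing \<open>exp (- t) = P (E > t)\<close> for a standard exponential \<open>E\<close> turns both the stable Laplace
  transform in the numerator and the resulting event for \<open>S'\<close> into Laplace transforms.\<close>

lemma nn_integral_stable_quotient:
  assumes \<mu>: "one_sided_stable_law \<gamma> \<mu>" and \<gamma>: "0 < \<gamma>" "\<gamma> \<le> 1" and y: "0 < y"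
  shows "(\<integral>\<^sup>+t. \<integral>\<^sup>+s. ennreal (1 / (1 + y * (s / t))) \<partial>\<mu> \<partial>\<mu>) = ennreal (1 / (1 + y powr \<gamma>))"
proof -
  interpret \<mu>: real_distribution \<mu> using \<mu> by (simp add: one_sided_stable_law_def)
  interpret E: prob_space exponential_law by (rule prob_space_exponential_law)
  interpret EE: pair_sigma_finite exponential_law exponential_law ..
  interpret EM: pair_sigma_finite exponential_law \<mu> ..
  have pos: "AE x in \<mu>. 0 < x" using one_sided_stable_law_AE_pos[OF \<mu> \<gamma>] .
  \<comment> \<open>The computation ends with the left-hand side for p =
    \<open>y powr \<gamma>\<close>.\<close>
  have frac: "1 - 1 / (1 + 1 / p) = 1 / (1 + p)" if "0 < p" for p :: real
    using that by (simp add: divide_simps add_pos_pos)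
  note lap = one_sided_stable_law_laplace[OF \<mu> \<gamma>]
  have "(\<integral>\<^sup>+t. \<integral>\<^sup>+s. ennreal (1 / (1 + y * (s / t))) \<partial>\<mu> \<partial>\<mu>) =
    (\<integral>\<^sup>+t. \<integral>\<^sup>+s. \<integral>\<^sup>+w. ennreal (exp (- (w * y / t * s))) \<partial>exponential_law \<partial>\<mu> \<partial>\<mu>)"
  proof (rule nn_integral_cong_AE)
    show "AE t in \<mu>. (\<integral>\<^sup>+s. ennreal (1 / (1 + y * (s / t))) \<partial>\<mu>) =
      (\<integral>\<^sup>+s. \<integral>\<^sup>+w. ennreal (exp (- (w * y / t * s))) \<partial>exponential_law \<partial>\<mu>)"
      using pos
    proof eventually_elim
      case (elim t)
      show ?case
      proof (rule nn_integral_cong_AE)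
        show "AE s in \<mu>. ennreal (1 / (1 + y * (s / t))) = (\<integral>\<^sup>+w. ennreal (exp (- (w * y / t * s))) \<partial>exponential_law)"
          using pos
        proof eventually_elim
          case (elim s)
          then show ?case using \<open>0 < t\<close> y nn_integral_exp_exponential_law[of "y * (s / t)"]
            by (simp add: mult_ac)
        qed
      qed
    qed
  qed
  also have "\<dots> = (\<integral>\<^sup>+t. \<integral>\<^sup>+w. \<integral>\<^sup>+s. ennreal (exp (- (w * y / t * s))) \<partial>\<mu> \<partial>exponential_law \<partial>\<mu>)"
    by (intro nn_integral_cong EM.Fubini') measurable
  \<comment> \<open>The integral over s is exp(-(wy/t)^\<gamma>), the probability that a second
    exponential variable u exceeds (wy/t)^\<gamma>. Solving this inequality for w isolates the first
    exponential variable.\<close>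
  also have "\<dots> = (\<integral>\<^sup>+t. \<integral>\<^sup>+w. \<integral>\<^sup>+u. indicator {..<t * (u powr (1 / \<gamma>) / y)} w \<partial>exponential_law \<partial>exponential_law \<partial>\<mu>)"
  proof (rule nn_integral_cong_AE)
    show "AE t in \<mu>. (\<integral>\<^sup>+w. \<integral>\<^sup>+s. ennreal (exp (- (w * y / t * s))) \<partial>\<mu> \<partial>exponential_law) =
      (\<integral>\<^sup>+w. \<integral>\<^sup>+u. indicator {..<t * (u powr (1 / \<gamma>) / y)} w \<partial>exponential_law \<partial>exponential_law)"
      using pos
    proof eventually_elim
      case (elim t)
      show ?case
      proof (rule nn_integral_cong_AE)
        show "AE w in exponential_law. (\<integral>\<^sup>+s. ennreal (exp (- (w * y / t * s))) \<partial>\<mu>) =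
          (\<integral>\<^sup>+u. indicator {..<t * (u powr (1 / \<gamma>) / y)} w \<partial>exponential_law)"
          using AE_exponential_law_pos
        proof eventually_elim
          case (elim w)
          have "(\<integral>\<^sup>+s. ennreal (exp (- (w * y / t * s))) \<partial>\<mu>) = emeasure exponential_law {(w * y / t) powr \<gamma><..}"
            using elim \<open>0 < t\<close> y by (subst lap) (simp_all add: exp_eq_emeasure_exponential_law)
          also have "\<dots> = (\<integral>\<^sup>+u. indicator {(w * y / t) powr \<gamma><..} u \<partial>exponential_law)"
            by simp
          also have "\<dots> = (\<integral>\<^sup>+u. indicator {..<t * (u powr (1 / \<gamma>) / y)} w \<partial>exponential_law)"
          proof (rule nn_integral_cong_AE)
            show "AE u in exponential_law. indicator {(w * y / t) powr \<gamma><..} u =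
                (indicator {..<t * (u powr (1 / \<gamma>) / y)} w :: ennreal)"
              using AE_exponential_law_pos
            proof eventually_elim
              case u: (elim u)
              have "(w * y / t) powr \<gamma> < u \<longleftrightarrow> (w * y / t) powr \<gamma> < (u powr (1 / \<gamma>)) powr \<gamma>"
                using u \<gamma> by (simp add: powr_powr)
              also have "\<dots> \<longleftrightarrow> w * y / t < u powr (1 / \<gamma>)"
                using powr_mono2[of \<gamma> "u powr (1 / \<gamma>)" "w * y / t"]
                  powr_less_mono2[of \<gamma> "w * y / t" "u powr (1 / \<gamma>)"]
                  powr_ge_zero[of u "1 / \<gamma>"] divide_nonneg_pos[of "w * y" t] elim \<open>0 < t\<close> y \<gamma>
                by (smt (verit) mult_nonneg_nonneg)
              also have "\<dots> \<longleftrightarrow> w < t * (u powr (1 / \<gamma>) / y)"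
                using \<open>0 < t\<close> y by (simp add: field_simps)
              finally show ?case by (simp add: indicator_def)
            qed
          qed
          finally show ?case .
        qed
      qed
    qed
  qed
  \<comment> \<open>With u and t fixed, the integral over w becomes an exponential distribution
    function, so t again occurs only in an exponent.\<close>
  also have "\<dots> = (\<integral>\<^sup>+t. \<integral>\<^sup>+u. \<integral>\<^sup>+w. indicator {..<t * (u powr (1 / \<gamma>) / y)} w \<partial>exponential_law \<partial>exponential_law \<partial>\<mu>)"
    by (intro nn_integral_cong EE.Fubini') (simp add: indicator_def case_prod_unfold)
  also have "\<dots> = (\<integral>\<^sup>+t. \<integral>\<^sup>+u. ennreal (1 - exp (- (u powr (1 / \<gamma>) / y * t))) \<partial>exponential_law \<partial>\<mu>)"
  proof (rule nn_integral_cong_AE)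
    show "AE t in \<mu>. (\<integral>\<^sup>+u. \<integral>\<^sup>+w. indicator {..<t * (u powr (1 / \<gamma>) / y)} w \<partial>exponential_law \<partial>exponential_law) =
       (\<integral>\<^sup>+u. ennreal (1 - exp (- (u powr (1 / \<gamma>) / y * t))) \<partial>exponential_law)"
      using pos
    proof eventually_elim
      case (elim t)
      then show ?case using y
        by (intro nn_integral_cong) (simp add: emeasure_exponential_law_lessThan mult_ac)
    qed
  qed
  also have "\<dots> = (\<integral>\<^sup>+u. \<integral>\<^sup>+t. ennreal (1 - exp (- (u powr (1 / \<gamma>) / y * t))) \<partial>\<mu> \<partial>exponential_law)"
    by (intro EM.Fubini') measurable
  \<comment> \<open>The second use of the stable Laplace transform, now for t at the point
    u^(1/\<gamma>)/y. Its \<gamma>-th power is linear in u, which leaves an exponential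
    transform.\<close>
  also have "\<dots> = (\<integral>\<^sup>+u. 1 - ennreal (exp (- (1 / y powr \<gamma> * u))) \<partial>exponential_law)"
  proof (rule nn_integral_cong_AE)
    show "AE u in exponential_law. (\<integral>\<^sup>+t. ennreal (1 - exp (- (u powr (1 / \<gamma>) / y * t))) \<partial>\<mu>) =
        1 - ennreal (exp (- (1 / y powr \<gamma> * u)))"
      using AE_exponential_law_pos
    proof eventually_elim
      case (elim u)
      have "(\<integral>\<^sup>+t. ennreal (1 - exp (- (u powr (1 / \<gamma>) / y * t))) \<partial>\<mu>) =
         (\<integral>\<^sup>+t. 1 - ennreal (exp (- (u powr (1 / \<gamma>) / y * t))) \<partial>\<mu>)"
        by (intro nn_integral_cong) (simp add: one_minus_ennreal)
      also have "\<dots> = (\<integral>\<^sup>+t. 1 \<partial>\<mu>) - (\<integral>\<^sup>+t. ennreal (exp (- (u powr (1 / \<gamma>) / y * t))) \<partial>\<mu>)"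
      proof (rule nn_integral_diff)
        show "(\<integral>\<^sup>+t. ennreal (exp (- (u powr (1 / \<gamma>) / y * t))) \<partial>\<mu>) \<noteq> \<infinity>"
          using y by (subst lap) auto
        show "AE t in \<mu>. ennreal (exp (- (u powr (1 / \<gamma>) / y * t))) \<le> 1"
          using pos by eventually_elim (use y in auto)
      qed auto
      also have "\<dots> = 1 - ennreal (exp (- ((u powr (1 / \<gamma>) / y) powr \<gamma>)))"
        using y by (subst lap) (simp_all add: \<mu>.emeasure_space_1[simplified])
      also have "(u powr (1 / \<gamma>) / y) powr \<gamma> = 1 / y powr \<gamma> * u"
        using y elim \<gamma> by (simp add: powr_divide powr_powr)
      finally show ?case .
    qed
  qed
  also have "\<dots> = (\<integral>\<^sup>+u. 1 \<partial>exponential_law) - (\<integral>\<^sup>+u. ennreal (exp (- (1 / y powr \<gamma> * u))) \<partial>exponential_law)"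
  proof (rule nn_integral_diff)
    show "(\<integral>\<^sup>+u. ennreal (exp (- (1 / y powr \<gamma> * u))) \<partial>exponential_law) \<noteq> \<infinity>"
      using y by (subst nn_integral_exp_exponential_law) auto
    show "AE u in exponential_law. ennreal (exp (- (1 / y powr \<gamma> * u))) \<le> 1"
      using AE_exponential_law_pos by eventually_elim (use y in auto)
  qed auto
  also have "\<dots> = ennreal (1 - 1 / (1 + 1 / y powr \<gamma>))"
    using y by (subst nn_integral_exp_exponential_law) (simp_all add: E.emeasure_space_1[simplified] one_minus_ennreal)
  finally show ?thesis
    using frac y by simp
qed

section \<open>Gamma integrals, gamma laws and their quotient\<close>

text \<open>Euler's integral for \<open>Gamma s\<close> after the substitution of bx for x.\<close>

lemma nn_integral_powr_exp:
  assumes s: "0 < s" and b: "0 < b"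
  shows "(\<integral>\<^sup>+x. ennreal (x powr (s - 1) * exp (- (b * x))) * indicator {0..} x \<partial>lborel) =
    ennreal (Gamma s / b powr s)" (is "?I = _")
proof -
  have "ennreal (Gamma s) = ennreal b * (\<integral>\<^sup>+x. ennreal (indicator {0..} (b * x) * (b * x) powr (s - 1) / exp (b * x)) \<partial>lborel)"
    using b by (subst Gamma_conv_nn_integral_real[OF s], subst nn_integral_real_affine[where c = b and t = 0]) auto
  also have "(\<integral>\<^sup>+x. ennreal (indicator {0..} (b * x) * (b * x) powr (s - 1) / exp (b * x)) \<partial>lborel) =
     (\<integral>\<^sup>+x. ennreal (b powr (s - 1)) * (ennreal (x powr (s - 1) * exp (- (b * x))) * indicator {0..} x) \<partial>lborel)"
    using b by (intro nn_integral_cong)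
       (auto simp: indicator_def powr_mult exp_minus field_simps zero_le_mult_iff simp flip: ennreal_mult)
  also have "\<dots> = ennreal (b powr (s - 1)) * ?I"
    by (rule nn_integral_cmult) measurable
  also have "ennreal b * (ennreal (b powr (s - 1)) * ?I) = ennreal (b powr s) * ?I"
    using b by (simp add: mult.assoc[symmetric] ennreal_mult[symmetric] powr_mult_base)
  \<comment> \<open>Multiplication by the reciprocal of \<open>b powr s\<close> isolates
    \<open>?I\<close>, which is not yet known to be finite.\<close>
  finally have "ennreal (1 / b powr s) * ennreal (Gamma s) = ennreal (1 / b powr s) * ennreal (b powr s) * ?I"
    by (simp add: mult.assoc)
  moreover have "ennreal (1 / b powr s) * ennreal (b powr s) = 1"
    using b by (simp add: ennreal_mult[symmetric])
  ultimately show ?thesis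
    using s b by (simp add: ennreal_mult[symmetric] Gamma_real_nonneg)
qed

lemma borel_measurable_gamma_density [measurable]: "gamma_density s \<in> borel_measurable borel"
  unfolding gamma_density_def[abs_def] by measurable

lemma sets_gamma_law [simp, measurable_cong]: "sets (gamma_law s) = sets borel"
  by (simp add: gamma_law_def)

lemma space_gamma_law [simp]: "space (gamma_law s) = UNIV"
  by (simp add: gamma_law_def)

lemma nn_integral_gamma_law:
  assumes s: "0 < s" and f[measurable]: "f \<in> borel_measurable borel"
  shows "(\<integral>\<^sup>+x. f x \<partial>gamma_law s) =
    ennreal (1 / Gamma s) * (\<integral>\<^sup>+x. ennreal (x powr (s - 1) * exp (- x)) * f x * indicator {0..} x \<partial>lborel)"
proof -
  have "(\<integral>\<^sup>+x. f x \<partial>gamma_law s) = (\<integral>\<^sup>+x. ennreal (gamma_density s x) * f x \<partial>lborel)"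
    using s by (simp add: gamma_law_def nn_integral_density)
  also have "\<dots> = (\<integral>\<^sup>+x. ennreal (1 / Gamma s) * (ennreal (x powr (s - 1) * exp (- x)) * f x * indicator {0..} x) \<partial>lborel)"
    using Gamma_real_pos[OF s]
    by (intro nn_integral_cong)
       (auto simp: gamma_density_def indicator_def mult.assoc[symmetric] divide_simps simp flip: ennreal_mult)
  also have "\<dots> = ennreal (1 / Gamma s) * (\<integral>\<^sup>+x. ennreal (x powr (s - 1) * exp (- x)) * f x * indicator {0..} x \<partial>lborel)"
    by (rule nn_integral_cmult) measurable
  finally show ?thesis .
qed

text \<open>The factor exp(-ax) only changes the rate of the gamma density from 1 to 1 + a. Shape 0
  is included because it occurs as 1 - r for r = 1; both sides are then 1.\<close>

lemma gamma_law_laplace: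
  assumes s: "0 \<le> s" and a: "0 \<le> a"
  shows "(\<integral>\<^sup>+x. ennreal (exp (- (a * x))) \<partial>gamma_law s) = ennreal ((1 + a) powr (- s))"
proof (cases "s = 0")
  case True
  then show ?thesis using a by (simp add: gamma_law_def nn_integral_return)
next
  case False
  with s have s: "0 < s" by simp
  have exp_eq: "exp (- ((1 + a) * x)) = exp (- x) * exp (- (a * x))" for x
    by (simp add: mult_exp_exp algebra_simps)
  have "(\<integral>\<^sup>+x. ennreal (exp (- (a * x))) \<partial>gamma_law s) =
     ennreal (1 / Gamma s) * (\<integral>\<^sup>+x. ennreal (x powr (s - 1) * exp (- ((1 + a) * x))) * indicator {0..} x \<partial>lborel)"
    unfolding exp_eq by (subst nn_integral_gamma_law[OF s])
       (auto intro!: arg_cong2[where f = "(*)"] nn_integral_cong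
         simp: indicator_def mult_ac simp flip: ennreal_mult)
  then show ?thesis
    using s a Gamma_real_pos[OF s]
    by (simp add: nn_integral_powr_exp powr_minus divide_simps flip: ennreal_mult)
qed

text \<open>The factor x raises the shape from s to s + 1, and Gamma(s + 1) = s Gamma(s) supplies
  the factor s. This avoids differentiating the Laplace transform.\<close>

lemma gamma_law_laplace_deriv:
  assumes s: "0 < s" and a: "0 \<le> a"
  shows "(\<integral>\<^sup>+x. ennreal (x * exp (- (a * x))) \<partial>gamma_law s) = ennreal (s * (1 + a) powr (- s - 1))"
proof -
  have exp_eq: "exp (- ((1 + a) * x)) = exp (- x) * exp (- (a * x))" for x
    by (simp add: mult_exp_exp algebra_simps)
  \<comment> \<open>At x = 0 both sides vanish because \<open>0 powr s = 0\<close>.\<close>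
  have powr_eq: "x powr s = x * x powr (s - 1)" if "0 \<le> x" for x
    using powr_mult_base[OF that, of "s - 1"] by simp
  have "(\<integral>\<^sup>+x. ennreal (x * exp (- (a * x))) \<partial>gamma_law s) = ennreal (1 / Gamma s) *
      (\<integral>\<^sup>+x. ennreal (x powr (s - 1) * exp (- x)) * ennreal (x * exp (- (a * x))) * indicator {0..} x \<partial>lborel)"
    by (rule nn_integral_gamma_law[OF s]) measurable
  also have "\<dots> = ennreal (1 / Gamma s) *
      (\<integral>\<^sup>+x. ennreal (x powr (s + 1 - 1) * exp (- ((1 + a) * x))) * indicator {0..} x \<partial>lborel)"
  proof (rule arg_cong2[where f = "(*)", OF refl], rule nn_integral_cong)
    fix x :: real
    show "ennreal (x powr (s - 1) * exp (- x)) * ennreal (x * exp (- (a * x))) * indicator {0..} x =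
      ennreal (x powr (s + 1 - 1) * exp (- ((1 + a) * x))) * indicator {0..} x"
      unfolding exp_eq using powr_eq[of x]
      by (cases "0 \<le> x") (simp_all add: mult_ac flip: ennreal_mult)
  qed
  also have "\<dots> = ennreal (1 / Gamma s) * ennreal (Gamma (s + 1) / (1 + a) powr (s + 1))"
    using s a by (subst nn_integral_powr_exp) auto
  also have "Gamma (s + 1) = s * Gamma s"
    using s by (intro Gamma_plus1) (auto simp: nonpos_Ints_def)
  also have "ennreal (1 / Gamma s) * ennreal (s * Gamma s / (1 + a) powr (s + 1)) = ennreal (s * (1 + a) powr - (s + 1))"
    using s a less_imp_neq[OF Gamma_real_pos[OF s]] unfolding powr_minus
    by (simp add: divide_simps flip: ennreal_mult)
  also have "- (s + 1) = - s - 1" by simp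
  finally show ?thesis .
qed

text \<open>The total mass is the Laplace transform at 0.\<close>

lemma prob_space_gamma_law:
  assumes "0 \<le> s"
  shows "prob_space (gamma_law s)"
  using gamma_law_laplace[OF assms, of 0] by (intro prob_spaceI) simp

lemma AE_gamma_law_pos:
  assumes "0 < s"
  shows "AE x in gamma_law s. 0 < x"
proof -
  have "AE x in lborel. x \<noteq> (0::real)" by (rule AE_lborel_singleton)
  moreover have "gamma_law s = density lborel (\<lambda>x. ennreal (gamma_density s x))"
    using assms by (simp add: gamma_law_def)
  ultimately show ?thesis
    by (simp only:) (subst AE_density, auto elim!: eventually_mono simp: gamma_density_def split: if_splits)
qed

lemma AE_gamma_law_nonneg:
  assumes "0 \<le> s"
  shows "AE x in gamma_law s. 0 \<le> x"
proof (cases "s = 0")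
  case True
  then show ?thesis unfolding gamma_law_def by (subst if_P) (auto simp: AE_return)
next
  case False
  with assms AE_gamma_law_pos[of s] show ?thesis by (auto elim!: eventually_mono)
qed

text \<open>\<open>g / ((1 + c) g + c h)\<close> is the integral of \<open>g exp (- v ((1 + c) g + c h))\<close> over \<open>v\<close>. By
  independence, what remains to be integrated is the derivative of
  \<open>- ((1 + v c) / (1 + v (1 + c))) powr r\<close>.\<close>

lemma nn_integral_gamma_quotient:
  assumes r: "0 < r" "r \<le> 1" and c: "0 < c"
  shows "(\<integral>\<^sup>+h. \<integral>\<^sup>+g. ennreal (1 / (1 + c * ((g + h) / g))) \<partial>gamma_law r \<partial>gamma_law (1 - r)) =
    ennreal (1 - (c / (1 + c)) powr r)"
proof -
  interpret G: prob_space "gamma_law r" using r by (intro prob_space_gamma_law) simp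
  interpret H: prob_space "gamma_law (1 - r)" using r by (intro prob_space_gamma_law) simp
  interpret LG: pair_sigma_finite lborel "gamma_law r" ..
  interpret LH: pair_sigma_finite lborel "gamma_law (1 - r)" ..
  have "(\<integral>\<^sup>+h. \<integral>\<^sup>+g. ennreal (1 / (1 + c * ((g + h) / g))) \<partial>gamma_law r \<partial>gamma_law (1 - r)) =
    (\<integral>\<^sup>+h. \<integral>\<^sup>+g. \<integral>\<^sup>+v. ennreal (exp (- (v * c * h))) * ennreal (g * exp (- (v * (1 + c) * g))) * indicator {0..} v
      \<partial>lborel \<partial>gamma_law r \<partial>gamma_law (1 - r))"
  proof (rule nn_integral_cong_AE)
    show "AE h in gamma_law (1 - r). (\<integral>\<^sup>+g. ennreal (1 / (1 + c * ((g + h) / g))) \<partial>gamma_law r) =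
      (\<integral>\<^sup>+g. \<integral>\<^sup>+v. ennreal (exp (- (v * c * h))) * ennreal (g * exp (- (v * (1 + c) * g))) * indicator {0..} v
      \<partial>lborel \<partial>gamma_law r)"
      using AE_gamma_law_nonneg[of "1 - r", simplified, OF r(2)]
    proof eventually_elim
      case (elim h)
      show ?case
      proof (rule nn_integral_cong_AE)
        show "AE g in gamma_law r. ennreal (1 / (1 + c * ((g + h) / g))) =
          (\<integral>\<^sup>+v. ennreal (exp (- (v * c * h))) * ennreal (g * exp (- (v * (1 + c) * g))) * indicator {0..} v \<partial>lborel)"
          using AE_gamma_law_pos[OF r(1)]
        proof eventually_elim
          case g: (elim g)
          define b where "b = (1 + c) * g + c * h"
          \<comment> \<open>Positivity comes from g alone: h may be 0, and is so almost surely when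
            r = 1.\<close>
          have b: "0 < b" using g elim c unfolding b_def by (intro add_pos_nonneg) auto
          have "(\<integral>\<^sup>+v. ennreal (exp (- (v * c * h))) * ennreal (g * exp (- (v * (1 + c) * g))) * indicator {0..} v \<partial>lborel) =
            (\<integral>\<^sup>+v. ennreal g * (ennreal (exp (- (b * v))) * indicator {0..} v) \<partial>lborel)"
            using g by (intro nn_integral_cong)
              (auto simp: indicator_def b_def algebra_simps mult_exp_exp simp flip: ennreal_mult)
          also have "\<dots> = ennreal (g / b)"
            using g b by (simp add: nn_integral_cmult nn_integral_exp_atLeast_0 flip: ennreal_mult)
          also have "g / b = 1 / (1 + c * ((g + h) / g))"
            using g b by (simp add: b_def field_simps)
          finally show ?case by simp
        qed
      qed
    qed
  qed
  also have "\<dots> = (\<integral>\<^sup>+h. \<integral>\<^sup>+v. \<integral>\<^sup>+g. ennreal (exp (- (v * c * h))) * ennreal (g * exp (- (v * (1 + c) * g))) * indicator {0..} v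
      \<partial>gamma_law r \<partial>lborel \<partial>gamma_law (1 - r))"
    by (intro nn_integral_cong LG.Fubini') measurable
  also have "\<dots> = (\<integral>\<^sup>+h. \<integral>\<^sup>+v. ennreal (exp (- (v * c * h))) * ennreal (r * (1 + v * (1 + c)) powr (- r - 1)) * indicator {0..} v
      \<partial>lborel \<partial>gamma_law (1 - r))"
    using r c by (intro nn_integral_cong)
      (auto simp: indicator_def nn_integral_cmult gamma_law_laplace_deriv)
  also have "\<dots> = (\<integral>\<^sup>+v. \<integral>\<^sup>+h. ennreal (exp (- (v * c * h))) * ennreal (r * (1 + v * (1 + c)) powr (- r - 1)) * indicator {0..} v
      \<partial>gamma_law (1 - r) \<partial>lborel)"
    by (intro LH.Fubini') measurable
  \<comment> \<open>The Laplace transform of shape 1 - r at vc contributes the exponent r -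
    1.\<close>
  also have "\<dots> = (\<integral>\<^sup>+v. ennreal ((1 + v * c) powr (r - 1) * (r * (1 + v * (1 + c)) powr (- r - 1))) * indicator {0..} v \<partial>lborel)"
    using r c by (intro nn_integral_cong)
      (auto simp: indicator_def nn_integral_multc gamma_law_laplace ennreal_mult)
  also have "\<dots> = ennreal (- ((c / (1 + c)) powr r) - (- ((1 + 0 * c) powr r * (1 + 0 * (1 + c)) powr (- r))))"
  proof (rule nn_integral_FTC_atLeast)
    show "((\<lambda>v. - ((1 + v * c) powr r * (1 + v * (1 + c)) powr (- r))) \<longlongrightarrow> - ((c / (1 + c)) powr r)) at_top"
    proof -
      \<comment> \<open>The two powers tend to infinity and to 0 separately, so the limit is taken
        for the power of their quotient.\<close>
      have "((\<lambda>v. - (((1 + v * c) / (1 + v * (1 + c))) powr r)) \<longlongrightarrow> - ((c / (1 + c)) powr r)) at_top"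
      proof (intro tendsto_minus tendsto_powr tendsto_const)
        have "((\<lambda>v. (1 + v * c) / (1 + v * (1 + c))) \<longlongrightarrow> c * inverse (1 + c)) at_top"
          using c by real_asymp
        then show "((\<lambda>v. (1 + v * c) / (1 + v * (1 + c))) \<longlongrightarrow> c / (1 + c)) at_top"
          by (simp add: divide_inverse)
      qed (use c in auto)
      moreover have "\<forall>\<^sub>F v in at_top. - (((1 + v * c) / (1 + v * (1 + c))) powr r) =
          - ((1 + v * c) powr r * (1 + v * (1 + c)) powr (- r))"
        using eventually_ge_at_top[of 0]
      proof eventually_elim
        case (elim v)
        then have "0 \<le> 1 + v * c" "0 \<le> 1 + v * (1 + c)" using c by auto
        then show ?case by (simp add: powr_divide powr_minus_divide)
      qed
      ultimately show ?thesis by (rule Lim_transform_eventually)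
    qed
    show "((\<lambda>v. - ((1 + v * c) powr r * (1 + v * (1 + c)) powr (- r))) has_real_derivative
       (1 + v * c) powr (r - 1) * (r * (1 + v * (1 + c)) powr (- r - 1))) (at v)" if "0 \<le> v" for v
    proof -
      define p q where "p = 1 + v * c" and "q = 1 + v * (1 + c)"
      have pq: "0 < p" "0 < q" using that c by (auto simp: p_def q_def intro!: add_pos_nonneg)
      have "((\<lambda>v. - ((1 + v * c) powr r * (1 + v * (1 + c)) powr (- r))) has_real_derivative
        - (p powr r * (- r * q powr (- r - 1) * (1 + c)) + r * p powr (r - 1) * c * q powr (- r))) (at v)"
        using pq unfolding p_def q_def by (auto intro!: derivative_eq_intros)
      \<comment> \<open>Splitting one factor p and one factor q off the powers gives both terms the
        common factor \<open>p powr (r - 1) * q powr (- r - 1)\<close>. What remains besides r is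
        p(1 + c) - cq, which is 1.\<close>
      also have "- (p powr r * (- r * q powr (- r - 1) * (1 + c)) + r * p powr (r - 1) * c * q powr (- r)) =
        - ((p * p powr (r - 1)) * (- r * q powr (- r - 1) * (1 + c)) + r * p powr (r - 1) * c * (q * q powr (- r - 1)))"
        using pq by (simp add: powr_mult_base)
      also have "\<dots> = p powr (r - 1) * (r * q powr (- r - 1)) * (p * (1 + c) - c * q)"
        by (simp add: algebra_simps)
      also have "p * (1 + c) - c * q = 1"
        by (simp add: p_def q_def algebra_simps)
      finally show ?thesis by (simp add: p_def q_def)
    qed
  qed (use r in auto)
  finally show ?thesis by simp
qed

section \<open>Uniqueness of laws, independence and Stieltjes measures\<close>

text \<open>The characteristic function determines the law. This identifies the laws of S and S',
  for which stability is assumed separately.\<close>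

lemma one_sided_stable_law_unique:
  assumes "one_sided_stable_law \<gamma> \<mu>" "one_sided_stable_law \<gamma> \<nu>"
  shows "\<mu> = \<nu>"
  using assms by (intro Levy_uniqueness) (auto simp: one_sided_stable_law_def fun_eq_iff)

text \<open>The joint law is a product, so Tonelli's theorem applies. The first form is for laws
  that are known explicitly; the second keeps both integrals over \<open>M\<close>, so that one
  variable can be integrated out while the other is frozen.\<close>

lemma (in prob_space) nn_integral_indep_var:
  assumes ind: "indep_var S X T Y" and f: "f \<in> borel_measurable (S \<Otimes>\<^sub>M T)"
  shows "(\<integral>\<^sup>+\<omega>. f (X \<omega>, Y \<omega>) \<partial>M) = (\<integral>\<^sup>+y. \<integral>\<^sup>+x. f (x, y) \<partial>distr M S X \<partial>distr M T Y)"
    and "(\<integral>\<^sup>+\<omega>. f (X \<omega>, Y \<omega>) \<partial>M) = (\<integral>\<^sup>+\<omega>. \<integral>\<^sup>+\<omega>'. f (X \<omega>', Y \<omega>) \<partial>M \<partial>M)"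
proof -
  have X [measurable]: "X \<in> measurable M S" and Y [measurable]: "Y \<in> measurable M T"
    using ind by (auto dest: indep_var_rv1 indep_var_rv2)
  interpret X: prob_space "distr M S X" by (rule prob_space_distr) fact
  interpret Y: prob_space "distr M T Y" by (rule prob_space_distr) fact
  interpret XY: pair_sigma_finite "distr M S X" "distr M T Y" ..
  note [measurable] = f
  have "(\<integral>\<^sup>+\<omega>. f (X \<omega>, Y \<omega>) \<partial>M) = (\<integral>\<^sup>+p. f p \<partial>distr M (S \<Otimes>\<^sub>M T) (\<lambda>\<omega>. (X \<omega>, Y \<omega>)))"
    by (subst nn_integral_distr) auto
  also have "\<dots> = (\<integral>\<^sup>+p. f p \<partial>(distr M S X \<Otimes>\<^sub>M distr M T Y))"
    using ind by (simp add: indep_var_distribution_eq)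
  also have "\<dots> = (\<integral>\<^sup>+y. \<integral>\<^sup>+x. f (x, y) \<partial>distr M S X \<partial>distr M T Y)"
    by (rule XY.nn_integral_snd[symmetric]) measurable
  finally show *: "(\<integral>\<^sup>+\<omega>. f (X \<omega>, Y \<omega>) \<partial>M) = (\<integral>\<^sup>+y. \<integral>\<^sup>+x. f (x, y) \<partial>distr M S X \<partial>distr M T Y)" .
  show "(\<integral>\<^sup>+\<omega>. f (X \<omega>, Y \<omega>) \<partial>M) = (\<integral>\<^sup>+\<omega>. \<integral>\<^sup>+\<omega>'. f (X \<omega>', Y \<omega>) \<partial>M \<partial>M)"
    unfolding * by (simp add: nn_integral_distr cong: nn_integral_cong)
qed

text \<open>For v > u, P(X < v) lies between the distribution function at u and at v, so its right
  limit at u is P(X \<le> u). The measure is therefore built from the usual distribution function,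
  which determines the law, atoms included.\<close>

lemma (in prob_space) stieltjes_measure_prob_less:
  assumes X [measurable]: "random_variable borel X"
  shows "stieltjes_measure (\<lambda>u. prob {\<omega> \<in> space M. X \<omega> < u}) = distr M borel X"
proof -
  interpret D: real_distribution "distr M borel X" by (rule real_distribution_distr) fact
  let ?A = "\<lambda>u. prob {\<omega> \<in> space M. X \<omega> < u}"
  have cdf: "cdf (distr M borel X) u = prob {\<omega> \<in> space M. X \<omega> \<le> u}" for u
    by (simp add: cdf_def measure_distr vimage_def Int_def conj_commute)
  have "(?A \<longlongrightarrow> cdf (distr M borel X) u) (at_right u)" for u
  proof (rule tendsto_sandwich[where f = "\<lambda>_. cdf (distr M borel X) u" and h = "cdf (distr M borel X)"])
    show "(cdf (distr M borel X) \<longlongrightarrow> cdf (distr M borel X) u) (at_right u)"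
      using D.cdf_is_right_cont by (simp add: continuous_within)
    show "\<forall>\<^sub>F v in at_right u. cdf (distr M borel X) u \<le> ?A v"
      using eventually_at_right_less[of u] unfolding cdf
      by eventually_elim (rule finite_measure_mono, auto)
    show "\<forall>\<^sub>F v in at_right u. ?A v \<le> cdf (distr M borel X) v"
      unfolding cdf by (intro always_eventually allI finite_measure_mono) auto
  qed simp
  then have "Lim (at_right u) ?A = cdf (distr M borel X) u" for u
    by (intro tendsto_Lim) auto
  then have "stieltjes_measure ?A = interval_measure (cdf (distr M borel X))"
    by (simp add: stieltjes_measure_def)
  also have "\<dots> = distr M borel X"
  proof (rule cdf_unique)
    show "real_distribution (interval_measure (cdf (distr M borel X)))"
      using D.cdf_nondecreasing D.cdf_is_right_cont D.cdf_lim_at_bot D.cdf_lim_at_top_prob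
      by (intro real_distribution_interval_measure) auto
    show "cdf (interval_measure (cdf (distr M borel X))) = cdf (distr M borel X)"
      using D.cdf_nondecreasing D.cdf_is_right_cont D.cdf_lim_at_bot
      by (intro cdf_interval_measure) auto
  qed (rule D.real_distribution_axioms)
  finally show ?thesis .
qed

section \<open>The mixed exponential representation\<close>

theorem corollary1:
  fixes M :: "'a measure"
    and r \<gamma> l :: real
    and W S S' G H R Z :: "'a \<Rightarrow> real"
    and A :: "real \<Rightarrow> real"
  assumes "0 < r" "r \<le> 1"
    and "0 < \<gamma>" "\<gamma> \<le> 1"
    and "0 < l"
    and "prob_space M"
    and "distributed M lborel W (exponential_density 1)"
    and "prob_space.indep_var M borel S borel S'"
    and "one_sided_stable_law \<gamma> (distr M borel S)"
    and "one_sided_stable_law \<gamma> (distr M borel S')"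
    and "\<And>\<omega>. R \<omega> = S \<omega> / S' \<omega>"
    and "prob_space.indep_var M borel G borel H"
    and "distr M borel G = gamma_law r"
    and "distr M borel H = gamma_law (1 - r)"
    and "\<And>\<omega>. Z \<omega> = l * (G \<omega> + H \<omega>) / G \<omega>"
    and "prob_space.indep_vars M (\<lambda>_. borel) (\<lambda>i. [W, R, Z] ! i) {..<3::nat}"
    and "\<And>u. A u = measure M {\<omega> \<in> space M. W \<omega> * R \<omega> * Z \<omega> powr (1 / \<gamma>) < u}"
  shows "\<forall>x\<ge>0. 1 - mixture_df r \<gamma> l x =
           (LINT u:{0..}|stieltjes_measure A. exp (- u * x))"
proof -
  interpret prob_space M by fact
  note r = assms(1,2) and \<gamma> = assms(3,4) and l = assms(5) and W_law = assms(7)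
    and SS' = assms(8) and S_law = assms(9) and S'_law = assms(10) and R_def = assms(11)
    and GH = assms(12) and G_law = assms(13) and H_law = assms(14) and Z_def = assms(15)
    and ind = assms(16) and A_def = assms(17)
  have rv: "(\<lambda>\<omega>. ([W, R, Z] ! i) \<omega>) \<in> borel_measurable M" if "i < 3" for i
    using ind that by (auto simp: indep_vars_def)
  have [measurable]: "W \<in> borel_measurable M" "R \<in> borel_measurable M" "Z \<in> borel_measurable M"
    using rv[of 0] rv[of 1] rv[of 2] by simp_all
  have [measurable]: "S \<in> borel_measurable M" "S' \<in> borel_measurable M"
    "G \<in> borel_measurable M" "H \<in> borel_measurable M"
    using SS' GH by (auto dest: indep_var_rv1 indep_var_rv2)
  define X where "X = (\<lambda>\<omega>. W \<omega> * R \<omega> * Z \<omega> powr (1 / \<gamma>))"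
  have X [measurable]: "random_variable borel X" unfolding X_def by measurable
  have "A = (\<lambda>u. prob {\<omega> \<in> space M. X \<omega> < u})"
    by (simp add: fun_eq_iff A_def X_def)
  then have stieltjes: "stieltjes_measure A = distr M borel X"
    by (simp add: stieltjes_measure_prob_less)

  have W_distr: "distr M borel W = exponential_law"
    using distributed_distr_eq_density[OF W_law] by (metis distr_cong sets_lborel)
  have W_transform: "(\<integral>\<^sup>+\<omega>. ennreal (exp (- (a * W \<omega>))) \<partial>M) = ennreal (1 / (1 + a))" if "0 \<le> a" for a
    using nn_integral_exp_exponential_law[OF that] unfolding W_distr[symmetric]
    by (subst (asm) nn_integral_distr) auto
  \<comment> \<open>\<open>V I\<close> is the subfamily with indices in I, where 0, 1, 2 stand for
    W, R, Z. Independence of W from the pair (R, Z) is that of the disjoint blocks {0} and {1,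
    2}.\<close>
  define V where "V = (\<lambda>I \<omega>. \<lambda>i\<in>I. ([W, R, Z] ! i) \<omega>)"
  have ind_W: "indep_var (PiM {0} (\<lambda>_. borel)) (V {0}) (PiM {1, 2} (\<lambda>_. borel)) (V {1, 2})"
    unfolding V_def by (rule indep_var_restrict[OF ind]) auto
  have ind_RZ: "indep_var borel R borel Z"
  proof -
    \<comment> \<open>The blocks {1} and {2} are projected back to their only coordinate.\<close>
    have "indep_var borel ((\<lambda>f. f 1) \<circ> (\<lambda>\<omega>. restrict (\<lambda>i. ([W, R, Z] ! i) \<omega>) {1}))
        borel ((\<lambda>f. f 2) \<circ> (\<lambda>\<omega>. restrict (\<lambda>i. ([W, R, Z] ! i) \<omega>) {2}))"
      by (intro indep_var_compose[OF indep_var_restrict[OF ind]]) auto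
    then show ?thesis by (simp add: comp_def)
  qed

  have W_pos: "AE \<omega> in M. 0 < W \<omega>"
    using AE_exponential_law_pos unfolding W_distr[symmetric] by (rule AE_distrD[rotated]) measurable
  have S_pos: "AE \<omega> in M. 0 < S \<omega>" and S'_pos: "AE \<omega> in M. 0 < S' \<omega>"
    using one_sided_stable_law_AE_pos[OF S_law \<gamma>] one_sided_stable_law_AE_pos[OF S'_law \<gamma>]
    by (auto elim!: AE_distrD[rotated])
  have R_pos: "AE \<omega> in M. 0 < R \<omega>" using S_pos S'_pos by eventually_elim (simp add: R_def)
  have G_pos: "AE \<omega> in M. 0 < G \<omega>"
    using AE_gamma_law_pos[OF r(1)] unfolding G_law[symmetric] by (rule AE_distrD[rotated]) measurable
  have H_nonneg: "AE \<omega> in M. 0 \<le> H \<omega>"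
    using AE_gamma_law_nonneg[of "1 - r"] r unfolding H_law[symmetric] by (auto elim: AE_distrD[rotated])
  have Z_pos: "AE \<omega> in M. 0 < Z \<omega>"
    using G_pos H_nonneg by eventually_elim (use l in \<open>simp add: Z_def\<close>)
  have X_nonneg: "AE \<omega> in M. 0 \<le> X \<omega>"
    using W_pos R_pos Z_pos by eventually_elim (simp add: X_def)

  have R_transform: "(\<integral>\<^sup>+\<omega>. ennreal (1 / (1 + y * R \<omega>)) \<partial>M) = ennreal (1 / (1 + y powr \<gamma>))"
    if "0 < y" for y
  proof -
    have "(\<integral>\<^sup>+\<omega>. ennreal (1 / (1 + y * R \<omega>)) \<partial>M) =
        (\<integral>\<^sup>+\<omega>. (\<lambda>(s, t). ennreal (1 / (1 + y * (s / t)))) (S \<omega>, S' \<omega>) \<partial>M)"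
      by (simp add: R_def)
    also have "\<dots> = (\<integral>\<^sup>+t. \<integral>\<^sup>+s. ennreal (1 / (1 + y * (s / t))) \<partial>distr M borel S \<partial>distr M borel S')"
      by (subst nn_integral_indep_var(1)[OF SS']) simp_all
    also have "\<dots> = ennreal (1 / (1 + y powr \<gamma>))"
      using nn_integral_stable_quotient[OF S_law \<gamma> that]
        one_sided_stable_law_unique[OF S'_law S_law] by simp
    finally show ?thesis .
  qed

  \<comment> \<open>Here x > 0 makes the argument of \<open>R_transform\<close> positive; x = 0 is
    treated at the end.\<close>
  have main: "(\<integral>\<^sup>+\<omega>. ennreal (exp (- (x * X \<omega>))) \<partial>M) = ennreal (1 - mixture_df r \<gamma> l x)"
    if x: "0 < x" for x
  proof -
    have "(\<integral>\<^sup>+\<omega>. ennreal (exp (- (x * X \<omega>))) \<partial>M) =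
      (\<integral>\<^sup>+\<omega>. (\<lambda>(p, q). ennreal (exp (- (x * q 2 powr (1 / \<gamma>) * q 1 * p 0)))) (V {0} \<omega>, V {1, 2} \<omega>) \<partial>M)"
      by (simp add: X_def V_def mult_ac)
    \<comment> \<open>W is integrated out first, with R and Z frozen; R follows, with Z
      frozen.\<close>
    also have "\<dots> = (\<integral>\<^sup>+\<omega>. \<integral>\<^sup>+\<omega>'. ennreal (exp (- (x * Z \<omega> powr (1 / \<gamma>) * R \<omega> * W \<omega>'))) \<partial>M \<partial>M)"
      by (subst nn_integral_indep_var(2)[OF ind_W]) (simp_all add: V_def)
    also have "\<dots> = (\<integral>\<^sup>+\<omega>. ennreal (1 / (1 + x * Z \<omega> powr (1 / \<gamma>) * R \<omega>)) \<partial>M)"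
    proof (rule nn_integral_cong_AE)
      show "AE \<omega> in M. (\<integral>\<^sup>+\<omega>'. ennreal (exp (- (x * Z \<omega> powr (1 / \<gamma>) * R \<omega> * W \<omega>'))) \<partial>M) =
          ennreal (1 / (1 + x * Z \<omega> powr (1 / \<gamma>) * R \<omega>))"
        using R_pos by eventually_elim (use x in \<open>simp add: W_transform\<close>)
    qed
    also have "\<dots> = (\<integral>\<^sup>+\<omega>. (\<lambda>(\<rho>, z). ennreal (1 / (1 + x * z powr (1 / \<gamma>) * \<rho>))) (R \<omega>, Z \<omega>) \<partial>M)"
      by simp
    also have "\<dots> = (\<integral>\<^sup>+\<omega>. \<integral>\<^sup>+\<omega>'. ennreal (1 / (1 + x * Z \<omega> powr (1 / \<gamma>) * R \<omega>')) \<partial>M \<partial>M)"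
      by (subst nn_integral_indep_var(2)[OF ind_RZ]) simp_all
    also have "\<dots> = (\<integral>\<^sup>+\<omega>. (\<lambda>(g, h). ennreal (1 / (1 + l * x powr \<gamma> * ((g + h) / g)))) (G \<omega>, H \<omega>) \<partial>M)"
    proof (rule nn_integral_cong_AE)
      show "AE \<omega> in M. (\<integral>\<^sup>+\<omega>'. ennreal (1 / (1 + x * Z \<omega> powr (1 / \<gamma>) * R \<omega>')) \<partial>M) =
         (\<lambda>(g, h). ennreal (1 / (1 + l * x powr \<gamma> * ((g + h) / g)))) (G \<omega>, H \<omega>)"
        using Z_pos
      proof eventually_elim
        case (elim \<omega>)
        \<comment> \<open>The exponent 1/\<gamma> on Z cancels against the power \<gamma> from the
          transform of R, which leaves the gamma quotient with c = l x^\<gamma>.\<close>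
        have "(x * Z \<omega> powr (1 / \<gamma>)) powr \<gamma> = l * x powr \<gamma> * ((G \<omega> + H \<omega>) / G \<omega>)"
          using x elim \<gamma> by (simp add: powr_mult powr_powr) (simp add: Z_def)
        then show ?case using x elim by (simp add: R_transform)
      qed
    qed
    also have "\<dots> = (\<integral>\<^sup>+h. \<integral>\<^sup>+g. ennreal (1 / (1 + l * x powr \<gamma> * ((g + h) / g))) \<partial>gamma_law r \<partial>gamma_law (1 - r))"
      by (subst nn_integral_indep_var(1)[OF GH]) (simp_all add: G_law H_law)
    also have "\<dots> = ennreal (1 - mixture_df r \<gamma> l x)"
      unfolding mixture_df_def using x l r by (intro nn_integral_gamma_quotient) auto
    finally show ?thesis .
  qed

  show ?thesis
  proof (intro allI impI)
    fix x :: real assume x: "0 \<le> x"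
    have "(LINT u:{0..}|stieltjes_measure A. exp (- u * x)) = (LINT \<omega>|M. indicator {0..} (X \<omega>) *\<^sub>R exp (- X \<omega> * x))"
      unfolding stieltjes set_lebesgue_integral_def by (rule integral_distr) measurable
    \<comment> \<open>Since X \<ge> 0 almost surely, the restriction to \<open>{0..}\<close> removes
      nothing.\<close>
    also have "\<dots> = (LINT \<omega>|M. exp (- (x * X \<omega>)))"
      by (rule integral_cong_AE) (use X_nonneg in \<open>auto elim!: eventually_mono simp: mult.commute\<close>)
    also have "\<dots> = 1 - mixture_df r \<gamma> l x"
    proof (cases "x = 0")
      \<comment> \<open>Both sides are 1: the integrand is constant and
        \<open>0 powr r = 0\<close>.\<close>
      case True
      then show ?thesis by (simp add: mixture_df_def prob_space)
    next
      case False
      \<comment> \<open>\<open>ennreal\<close> sends negative reals to 0, so this bound is what lets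
        \<open>main\<close> be read as an equation between reals.\<close>
      have "mixture_df r \<gamma> l x \<le> 1"
        unfolding mixture_df_def using l r by (intro powr_le1) (auto simp: divide_simps add_nonneg_pos add_pos_nonneg)
      then show ?thesis
        using False x main[of x] by (subst integral_eq_nn_integral) auto
    qed
    finally show "1 - mixture_df r \<gamma> l x = (LINT u:{0..}|stieltjes_measure A. exp (- u * x))" ..
  qed
qed

end
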